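(* Let $\Phi$, $\varphi$, $V$ be as in the standing assumption (see context), and let $\Omega\subset\mathbb R^d$ be an open set. If $\varphi\in\mathcal Z_{\rm b,loc}(\Omega)\cap C(\Omega)$, then $V\in C(\Omega)$.
   Context: Notation: $B_r(a)$ is the open ball in $\mathbb R^d$; $D_hf(x)=f(x+h)-2f(x)+f(x-h)$. $\Phi$ is a complete Bernstein function with Lévy pair $(0,\mu)$: $\Phi(u)=\int_0^\infty(1-e^{-ut})\mu(t)\,dt$ with $\mu:(0,\infty)\to[0,\infty)$ completely monotone and $\int_0^\infty\min(1,t)\mu(t)\,dt<\infty$. The jump kernel is $j(r)=(4\pi)^{-d/2}\int_0^\infty t^{-d/2}e^{-r^2/(4t)}\mu(t)\,dt$, $r>0$. $\Phi(-\Delta)$ is the operator on $L^2(\mathbb R^d)$ with Fourier multiplier $\Phi(|y|^2)$. Standing assumption: $V:\mathbb R^d\to\mathbb R$ is a potential, $H=\Phi(-\Delta)+V$, and $\varphi\in L^2(\mathbb R^d)\cap L^\infty(\mathbb R^d)$, $\varphi>0$, satisfies $H\varphi=0$. The potential is understood through the pointwise expression $V(x)=-\frac{1}{\varphi(x)}\Phi(-\Delta)\varphi(x)=\frac{1}{2\varphi(x)}\int_{\mathbb R^d}D_h\varphi(x)\,j(|h|)\,dh$. Spaces: $\mathcal Z_{\rm b}(\Omega)$ is the set of $f\in L^\infty(\mathbb R^d)$ for which there exist a constant $R_f>0$ and a bounded function $L_f:\Omega\to(0,\infty)$ such that $|D_hf(x)|\le L_f(x)|h|^2$ for all $x\in\Omega$,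 $h\in B_{R_f}(0)$. $f\in\mathcal Z_{\rm b,loc}(\Omega)$ means $f\in\mathcal Z_{\rm b}(K)$ for every compact $K\subset\Omega$. *)

theory Defs
  imports "HOL-Analysis.Analysis"
begin

text \<open>Euclidean space of dimension \<open>d\<close> is a type \<^typ>\<open>'a::euclidean_space\<close> with \<open>d = DIM('a)\<close>.
  Elements of \<open>L\<^sup>2\<close> and \<open>L\<^sup>\<infinity>\<close> are represented by Lebesgue measurable functions. Equalities in
  \<open>L\<^sup>2\<close> are almost everywhere; values at points refer to the given representative.\<close>

definition in_L2 :: "('a::euclidean_space \<Rightarrow> complex) \<Rightarrow> bool" where
  "in_L2 f \<longleftrightarrow> f \<in> borel_measurable lebesgue \<and> integrable lebesgue (\<lambda>x. (norm (f x))\<^sup>2)"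

definition in_Linf :: "('a::euclidean_space \<Rightarrow> real) \<Rightarrow> bool" where
  "in_Linf f \<longleftrightarrow> f \<in> borel_measurable lebesgue \<and> (\<exists>C. AE x in lebesgue. \<bar>f x\<bar> \<le> C)"

text \<open>Functions on \<open>(0,\<infinity>)\<close> are total functions whose values outside \<open>(0,\<infinity>)\<close> are irrelevant.\<close>

definition completely_monotone :: "(real \<Rightarrow> real) \<Rightarrow> bool" where
  "completely_monotone \<mu> \<longleftrightarrow>
     (\<forall>n. \<forall>t>0. (deriv ^^ n) \<mu> field_differentiable (at t) \<and> (-1) ^ n * (deriv ^^ n) \<mu> t \<ge> 0)"

definition complete_bernstein :: "(real \<Rightarrow> real) \<Rightarrow> (real \<Rightarrow> real) \<Rightarrow> bool" where
  "complete_bernstein \<Phi> \<mu> \<longleftrightarrow>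
     completely_monotone \<mu> \<and>
     set_integrable lborel {0<..} (\<lambda>t. min 1 t * \<mu> t) \<and>
     (\<forall>u>0. \<Phi> u = (LBINT t:{0<..}. (1 - exp (- (u * t))) * \<mu> t))"

definition jump_kernel :: "nat \<Rightarrow> (real \<Rightarrow> real) \<Rightarrow> real \<Rightarrow> real" where
  "jump_kernel d \<mu> r =
     (4 * pi) powr (- real d / 2) *
     (LBINT t:{0<..}. t powr (- real d / 2) * exp (- (r\<^sup>2 / (4 * t))) * \<mu> t)"

definition second_diff :: "'a::euclidean_space \<Rightarrow> ('a \<Rightarrow> real) \<Rightarrow> 'a \<Rightarrow> real" where
  "second_diff h f x = f (x + h) - 2 * f x + f (x - h)"

definition fourier_L1 :: "('a::euclidean_space \<Rightarrow> complex) \<Rightarrow> 'a \<Rightarrow> complex" where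
  "fourier_L1 f y =
     of_real ((2 * pi) powr (- real DIM('a) / 2)) * (LINT x|lebesgue. cis (- (x \<bullet> y)) * f x)"

text \<open>The Fourier-Plancherel transform, as a relation: \<open>F\<close> is the \<open>L\<^sup>2\<close> limit of the Fourier
  integrals of \<open>f\<close> cut off to balls. The \<open>L\<^sup>2\<close> distance is a nonnegative integral because the
  Bochner integral would be 0 if it diverged.\<close>

definition fourier_L2 ::
    "('a::euclidean_space \<Rightarrow> complex) \<Rightarrow> ('a \<Rightarrow> complex) \<Rightarrow> bool" where
  "fourier_L2 f F \<longleftrightarrow> in_L2 f \<and> in_L2 F \<and>
     (\<lambda>n. \<integral>\<^sup>+ y. ennreal ((norm (F y - fourier_L1 (\<lambda>x. indicator (ball 0 (real n)) x * f x) y))\<^sup>2)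
           \<partial>lebesgue) \<longlonglongrightarrow> 0"

text \<open>\<open>Phi_laplacian \<Phi> f g\<close>: \<open>f\<close> lies in the domain of the operator \<open>\<Phi>(-\<Delta>)\<close> on \<open>L\<^sup>2\<close>, and
  \<open>\<Phi>(-\<Delta>) f = g\<close>.\<close>

definition Phi_laplacian ::
    "(real \<Rightarrow> real) \<Rightarrow> ('a::euclidean_space \<Rightarrow> complex) \<Rightarrow> ('a \<Rightarrow> complex) \<Rightarrow> bool" where
  "Phi_laplacian \<Phi> f g \<longleftrightarrow>
     (\<exists>F. fourier_L2 f F \<and> fourier_L2 g (\<lambda>y. of_real (\<Phi> ((norm y)\<^sup>2)) * F y))"

text \<open>\<open>H \<phi> = 0\<close> in \<open>L\<^sup>2\<close>, where \<open>H = \<Phi>(-\<Delta>) + V\<close>.\<close>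

definition zero_energy_solution ::
    "(real \<Rightarrow> real) \<Rightarrow> ('a::euclidean_space \<Rightarrow> real) \<Rightarrow> ('a \<Rightarrow> real) \<Rightarrow> bool" where
  "zero_energy_solution \<Phi> V \<phi> \<longleftrightarrow>
     (\<exists>g. Phi_laplacian \<Phi> (\<lambda>x. of_real (\<phi> x)) g \<and>
          (AE x in lebesgue. g x + of_real (V x * \<phi> x) = 0))"

text \<open>The equation \<open>H \<phi> = 0\<close> determines \<open>V\<close> only almost everywhere. The following condition
  selects its values at every point where the integral converges absolutely; it says nothing at
  other points, where the Bochner integral would have the meaningless value 0.\<close>

definition pointwise_potential ::
    "(real \<Rightarrow> real) \<Rightarrow> ('a::euclidean_space \<Rightarrow> real) \<Rightarrow> ('a \<Rightarrow> real) \<Rightarrow> bool" where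
  "pointwise_potential \<mu> V \<phi> \<longleftrightarrow>
     (\<forall>x. integrable lebesgue (\<lambda>h. second_diff h \<phi> x * jump_kernel DIM('a) \<mu> (norm h)) \<longrightarrow>
          V x = 1 / (2 * \<phi> x) *
            (LINT h|lebesgue. second_diff h \<phi> x * jump_kernel DIM('a) \<mu> (norm h)))"

definition Z_b :: "'a::euclidean_space set \<Rightarrow> ('a \<Rightarrow> real) set" where
  "Z_b \<Omega> = {f. in_Linf f \<and>
     (\<exists>R L. R > 0 \<and> (\<forall>x\<in>\<Omega>. L x > (0::real)) \<and> bounded (L ` \<Omega>) \<and>
        (\<forall>x\<in>\<Omega>. \<forall>h\<in>ball 0 R. \<bar>second_diff h f x\<bar> \<le> L x * (norm h)\<^sup>2))}"

definition Z_b_loc :: "'a::euclidean_space set \<Rightarrow> ('a \<Rightarrow> real) set" where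
  "Z_b_loc \<Omega> = {f. \<forall>K. compact K \<and> K \<subseteq> \<Omega> \<longrightarrow> f \<in> Z_b K}"

end

theory Submission
  imports Defs "HOL-Probability.Distributions"
begin

text \<open>
  Fix \<open>a \<in> \<Omega>\<close>. Since \<open>\<phi>\<close> is continuous and positive, it suffices that the integral of
  \<open>second_diff h \<phi> x * j (norm h)\<close> over \<open>h\<close> converges absolutely for \<open>x = a\<close> and is continuous
  in \<open>x\<close> at \<open>a\<close>; absolute convergence is what lets the pointwise formula for \<open>V\<close> apply.

  Two properties of the jump kernel \<open>j\<close> carry the proof. It is a mixture of heat kernels with
  mixing density \<open>\<mu>\<close>, so it is nonnegative, nonincreasing and continuous on \<open>(0,\<infinity>)\<close>
  (\<open>kernel_antimono\<close>, \<open>kernel_tendsto\<close>). It is a Levy density: \<open>min 1 ((norm h)\<^sup>2)\<close> is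
  integrable against it (\<open>integrable_truncated_kernel\<close>), because the heat kernel at time \<open>t\<close> is a
  probability density with second moment \<open>2 * d * t\<close>, which turns this condition into the
  integrability of \<open>min 1 t * \<mu> t\<close>.

  For small \<open>\<rho> > 0\<close>, split \<open>j (norm h)\<close> into the flattened kernel \<open>j (max \<rho> (norm h))\<close> and the
  remainder. The remainder lives in the ball of radius \<open>\<rho>\<close>. There the second difference
  is bounded by \<open>M * (norm h)\<^sup>2\<close> uniformly for \<open>x\<close> near \<open>a\<close>, and it depends continuously on \<open>x\<close>
  because \<open>x \<plusminus> h\<close> stays in \<open>\<Omega>\<close>; dominated convergence applies (\<open>second_diff_integral_near\<close>).

  The flattened kernel is integrable, bounded and continuous, but \<open>\<phi>\<close> is merely essentially bounded
  and measurable away from \<open>\<Omega>\<close>. A translation moves the dependence on \<open>x\<close> from \<open>\<phi>\<close> to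
  the kernel (\<open>convolution_tendsto\<close>). The shifted kernels have a common integrable bound: by
  monotonicity of \<open>j\<close>, the value of the flattened kernel at \<open>z + u\<close> with \<open>norm u < \<rho>\<close> is at most
  \<open>j (max \<rho> (norm z / 2))\<close> (\<open>flattened_kernel_shift_le\<close>).
\<close>

section \<open>The heat kernel\<close>

text \<open>The radial profile of the Gauss--Weierstrass kernel of \<open>\<Delta>\<close> on \<open>d\<close>-dimensional space, with
  radius \<open>r\<close> and time \<open>t\<close>.\<close>
definition heat_kernel :: "nat \<Rightarrow> real \<Rightarrow> real \<Rightarrow> real" where
  "heat_kernel d r t =
     (4 * pi) powr (- real d / 2) * (t powr (- real d / 2) * exp (- (r\<^sup>2 / (4 * t))))"

lemma heat_kernel_nonneg: "0 \<le> heat_kernel d r t"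
  by (simp add: heat_kernel_def)

lemma heat_kernel_antimono:
  assumes "0 \<le> r" "r \<le> s" "0 < t"
  shows "heat_kernel d s t \<le> heat_kernel d r t"
proof -
  have "r\<^sup>2 / (4 * t) \<le> s\<^sup>2 / (4 * t)"
    using assms by (intro divide_right_mono power_mono) auto
  then show ?thesis
    unfolding heat_kernel_def by (intro mult_left_mono) auto
qed

lemma heat_kernel_measurable [measurable]:
  assumes [measurable]: "f \<in> borel_measurable M" "g \<in> borel_measurable M"
  shows "(\<lambda>x. heat_kernel d (f x) (g x)) \<in> borel_measurable M"
  unfolding heat_kernel_def by measurable

text \<open>Away from the origin the exponential factor beats every power of \<open>t\<close> as \<open>t\<close> tends to 0, and
  the heat kernel is bounded as \<open>t\<close> tends to infinity. Hence it is dominated by the weight against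
  which \<open>\<mu>\<close> is integrable.\<close>
lemma heat_kernel_bound:
  assumes "r > 0"
  obtains C where "C \<ge> 0" "\<And>t. t > 0 \<Longrightarrow> heat_kernel d r t \<le> C * min 1 t"
proof -
  \<comment> \<open>\<open>n \<ge> d / 2 + 1\<close> leaves one spare power of \<open>t\<close>, and \<open>n > 0\<close> is required for \<open>(1 + x / n) ^ n\<close>.\<close>
  define n where "n = Suc d"
  define K where "K = (4 * real n / r\<^sup>2) ^ n"
  define C where "C = (4 * pi) powr (- real d / 2) * max 1 K"
  have "K \<ge> 0"
    by (simp add: K_def)
  have "t powr (- real d / 2) * exp (- (r\<^sup>2 / (4 * t))) \<le> max 1 K * min 1 t" if "t > 0" for t
  proof (cases "t \<le> 1")
    case True
    define x where "x = r\<^sup>2 / (4 * t)"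
    have "x > 0"
      using assms that by (simp add: x_def)
    have "(x / real n) ^ n \<le> (1 + x / real n) ^ n"
      using \<open>x > 0\<close> by (intro power_mono) auto
    also have "\<dots> \<le> exp x"
      using \<open>x > 0\<close> by (intro exp_ge_one_plus_x_over_n_power_n) (auto simp: n_def)
    finally have "exp (- x) \<le> inverse ((x / real n) ^ n)"
      unfolding exp_minus using \<open>x > 0\<close> by (intro le_imp_inverse_le) (auto simp: n_def)
    also have "\<dots> = K * t ^ n"
      using assms that by (simp add: K_def x_def field_simps power_mult_distrib)
    finally have "t powr (- real d / 2) * exp (- x) \<le> t powr (- real d / 2) * (K * t ^ n)"
      by (intro mult_left_mono) auto
    also have "\<dots> = K * (t powr (- real d / 2) * t powr real n)"
      using that by (simp add: powr_realpow)
    also have "\<dots> = K * t powr (1 + real d / 2)"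
    proof -
      have "- real d / 2 + real n = 1 + real d / 2"
        by (simp add: n_def field_simps)
      then show ?thesis
        by (simp only: flip: powr_add)
    qed
    also have "\<dots> \<le> K * t powr 1"
      using True that \<open>K \<ge> 0\<close> by (intro mult_left_mono powr_mono') auto
    also have "\<dots> \<le> max 1 K * min 1 t"
      using True that by (auto intro: mult_right_mono)
    finally show ?thesis
      by (simp add: x_def)
  next
    case False
    then have "t powr (- real d / 2) \<le> 1"
      using powr_mono[of "- real d / 2" 0 t] by simp
    then have "t powr (- real d / 2) * exp (- (r\<^sup>2 / (4 * t))) \<le> 1 * 1"
      using that by (intro mult_mono) auto
    also have "\<dots> \<le> max 1 K * min 1 t"
      using False by auto
    finally show ?thesis .
  qed
  then have "heat_kernel d r t \<le> C * min 1 t" if "t > 0" for t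
    using that by (simp add: heat_kernel_def C_def mult.assoc mult_left_mono)
  moreover have "C \<ge> 0"
    by (simp add: C_def)
  ultimately show thesis
    using that by blast
qed

lemma norm_sq_eq_sum_inner_sq: "(norm h)\<^sup>2 = (\<Sum>b\<in>Basis. (h \<bullet> b)\<^sup>2)"
  unfolding power2_norm_eq_inner by (subst euclidean_inner) (simp add: power2_eq_square)

text \<open>This identifies the heat kernel with the law of independent centred normal coordinates of
  variance \<open>2 * t\<close>; its moments reduce to one-dimensional ones.\<close>
lemma heat_kernel_eq_prod_normal_density:
  fixes h :: "'a::euclidean_space"
  assumes "t > 0"
  shows "heat_kernel DIM('a) (norm h) t = (\<Prod>b\<in>Basis. normal_density 0 (sqrt (2 * t)) (h \<bullet> b))"
proof -
  have "exp (- ((norm h)\<^sup>2 / (4 * t))) = exp (\<Sum>b\<in>Basis. - (h \<bullet> b)\<^sup>2 / (4 * t))"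
    by (simp add: norm_sq_eq_sum_inner_sq[of h] sum_negf sum_divide_distrib)
  also have "\<dots> = (\<Prod>b\<in>Basis. exp (- (h \<bullet> b)\<^sup>2 / (4 * t)))"
    by (simp add: exp_sum)
  finally have e: "exp (- ((norm h)\<^sup>2 / (4 * t))) = (\<Prod>b\<in>Basis. exp (- (h \<bullet> b)\<^sup>2 / (4 * t)))" .
  have "(4 * pi) powr (- real DIM('a) / 2) * t powr (- real DIM('a) / 2)
      = ((4 * pi * t) powr (- 1 / 2)) powr real DIM('a)"
    using assms by (simp add: powr_mult powr_powr)
  also have "\<dots> = (1 / sqrt (4 * pi * t)) ^ DIM('a)"
    using assms by (simp add: powr_minus powr_half_sqrt powr_realpow divide_simps)
  finally have c: "(4 * pi) powr (- real DIM('a) / 2) * t powr (- real DIM('a) / 2)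
      = (1 / sqrt (4 * pi * t)) ^ DIM('a)" .
  have "normal_density 0 (sqrt (2 * t)) x = 1 / sqrt (4 * pi * t) * exp (- x\<^sup>2 / (4 * t))" for x
    using assms by (simp add: normal_density_def mult.commute)
  then show ?thesis
    by (simp only: heat_kernel_def prod.distrib prod_constant e mult.assoc[symmetric] c)
qed

lemma nn_integral_heat_kernel:
  assumes "t > 0"
  shows "(\<integral>\<^sup>+(h::'a::euclidean_space). heat_kernel DIM('a) (norm h) t \<partial>lborel) = 1"
proof -
  define \<sigma> where "\<sigma> = sqrt (2 * t)"
  have "\<sigma> > 0" using assms by (simp add: \<sigma>_def)
  have "(\<integral>\<^sup>+(h::'a). heat_kernel DIM('a) (norm h) t \<partial>lborel)
      = (\<integral>\<^sup>+(h::'a). (\<Prod>b\<in>Basis. ennreal (normal_density 0 \<sigma> (h \<bullet> b))) \<partial>lborel)"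
    using assms by (simp add: heat_kernel_eq_prod_normal_density \<sigma>_def prod_ennreal)
  also have "\<dots> = (\<Prod>b\<in>(Basis::'a set). \<integral>\<^sup>+x. ennreal (normal_density 0 \<sigma> x) \<partial>lborel)"
    by (intro nn_integral_lborel_prod) auto
  also have "\<dots> = 1"
    using \<open>\<sigma> > 0\<close> by (simp add: nn_integral_eq_integral)
  finally show ?thesis .
qed

lemma nn_integral_heat_kernel_second_moment:
  assumes "t > 0"
  shows "(\<integral>\<^sup>+(h::'a::euclidean_space). (norm h)\<^sup>2 * heat_kernel DIM('a) (norm h) t \<partial>lborel)
    = 2 * real DIM('a) * t"
proof -
  define \<sigma> where "\<sigma> = sqrt (2 * t)"
  have "\<sigma> > 0" using assms by (simp add: \<sigma>_def)
  \<comment> \<open>Expanding the square of the norm over coordinates \<open>b\<close> leaves product densities in which only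
    the factor \<open>b' = b\<close> carries the extra square.\<close>
  define w where "w b b' x = (if b' = b then normal_density 0 \<sigma> x * x\<^sup>2 else normal_density 0 \<sigma> x)"
    for b b' :: 'a and x :: real
  have w_nonneg: "0 \<le> w b b' x" for b b' x
    by (simp add: w_def)
  have w_meas [measurable]: "w b b' \<in> borel_measurable borel" for b b'
    by (cases "b' = b") (simp_all add: w_def[abs_def])
  have w_int: "(\<integral>\<^sup>+x. ennreal (w b b' x) \<partial>lborel) = (if b' = b then ennreal (2 * t) else 1)" for b b'
  proof (cases "b' = b")
    case True
    have "has_bochner_integral lborel (\<lambda>x. normal_density 0 \<sigma> x * x\<^sup>2) (2 * t)"
      using normal_moment_even[OF \<open>\<sigma> > 0\<close>, of 0 1] assms by (simp add: \<sigma>_def fact_2)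
    then show ?thesis
      using True by (simp add: w_def has_bochner_integral_iff nn_integral_eq_integral)
  next
    case False
    then show ?thesis
      using \<open>\<sigma> > 0\<close> by (simp add: w_def nn_integral_eq_integral)
  qed
  have "(norm h)\<^sup>2 * heat_kernel DIM('a) (norm h) t
      = (\<Sum>b\<in>Basis. \<Prod>b'\<in>Basis. w b b' (h \<bullet> b'))" for h :: 'a
  proof -
    have "(\<Prod>b'\<in>Basis. w b b' (h \<bullet> b'))
        = (h \<bullet> b)\<^sup>2 * (\<Prod>b'\<in>Basis. normal_density 0 \<sigma> (h \<bullet> b'))" if "b \<in> Basis" for b
    proof -
      have "(\<Prod>b'\<in>Basis. w b b' (h \<bullet> b'))
          = (\<Prod>b'\<in>Basis. (if b' = b then (h \<bullet> b)\<^sup>2 else 1) * normal_density 0 \<sigma> (h \<bullet> b'))"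
        by (intro prod.cong) (auto simp: w_def)
      then show ?thesis
        using that by (simp add: prod.distrib)
    qed
    then show ?thesis
      using assms by (simp add: norm_sq_eq_sum_inner_sq[of h] heat_kernel_eq_prod_normal_density \<sigma>_def sum_distrib_right)
  qed
  then have "(\<integral>\<^sup>+(h::'a). (norm h)\<^sup>2 * heat_kernel DIM('a) (norm h) t \<partial>lborel)
      = (\<integral>\<^sup>+(h::'a). (\<Sum>b\<in>Basis. \<Prod>b'\<in>Basis. ennreal (w b b' (h \<bullet> b'))) \<partial>lborel)"
    by (simp add: prod_ennreal w_nonneg sum_ennreal prod_nonneg)
  also have "\<dots> = (\<Sum>b\<in>(Basis::'a set). \<integral>\<^sup>+h. (\<Prod>b'\<in>Basis. ennreal (w b b' (h \<bullet> b'))) \<partial>lborel)"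
    by (intro nn_integral_sum) measurable
  also have "\<dots> = (\<Sum>b\<in>(Basis::'a set). \<Prod>b'\<in>(Basis::'a set). \<integral>\<^sup>+x. ennreal (w b b' x) \<partial>lborel)"
    by (intro sum.cong refl nn_integral_lborel_prod) auto
  also have "\<dots> = (\<Sum>b\<in>(Basis::'a set). ennreal (2 * t))"
    by (simp add: w_int)
  also have "\<dots> = 2 * real DIM('a) * t"
    using assms by (simp add: ennreal_of_nat_eq_real_of_nat flip: ennreal_mult' )
  finally show ?thesis .
qed

text \<open>The total mass bounds the integral by 1, the second moment by \<open>2 * d * t\<close>.\<close>
lemma nn_integral_heat_kernel_truncated:
  assumes "t > 0"
  shows "(\<integral>\<^sup>+(h::'a::euclidean_space). min 1 ((norm h)\<^sup>2) * heat_kernel DIM('a) (norm h) t \<partial>lborel)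
    \<le> ennreal (2 * real DIM('a) * min 1 t)"
proof -
  have "(\<integral>\<^sup>+(h::'a). min 1 ((norm h)\<^sup>2) * heat_kernel DIM('a) (norm h) t \<partial>lborel)
      \<le> (\<integral>\<^sup>+(h::'a). heat_kernel DIM('a) (norm h) t \<partial>lborel)"
    by (intro nn_integral_mono ennreal_leI mult_left_le_one_le heat_kernel_nonneg) auto
  also have "\<dots> = ennreal 1"
    using nn_integral_heat_kernel[OF assms] by simp
  finally have 1: "(\<integral>\<^sup>+(h::'a). min 1 ((norm h)\<^sup>2) * heat_kernel DIM('a) (norm h) t \<partial>lborel) \<le> ennreal 1" .
  have "(\<integral>\<^sup>+(h::'a). min 1 ((norm h)\<^sup>2) * heat_kernel DIM('a) (norm h) t \<partial>lborel)
      \<le> (\<integral>\<^sup>+(h::'a). (norm h)\<^sup>2 * heat_kernel DIM('a) (norm h) t \<partial>lborel)"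
    by (intro nn_integral_mono ennreal_leI mult_right_mono heat_kernel_nonneg) auto
  also have "\<dots> = ennreal (2 * real DIM('a) * t)"
    using nn_integral_heat_kernel_second_moment[OF assms] by simp
  finally have 2: "(\<integral>\<^sup>+(h::'a). min 1 ((norm h)\<^sup>2) * heat_kernel DIM('a) (norm h) t \<partial>lborel)
    \<le> ennreal (2 * real DIM('a) * t)" .
  have "1 \<le> 2 * real DIM('a)"
    using DIM_positive[where 'a='a] by linarith
  then show ?thesis
    using order.trans[OF 1 ennreal_leI[of 1 "2 * real DIM('a)"]] 2 by (simp add: min_def)
qed

section \<open>The jump kernel as a mixture of heat kernels\<close>

locale levy_density =
  fixes \<mu> :: "real \<Rightarrow> real"
  assumes nonneg: "t > 0 \<Longrightarrow> 0 \<le> \<mu> t"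
    and integrable_min: "set_integrable lborel {0<..} (\<lambda>t. min 1 t * \<mu> t)"
begin

text \<open>Measurability of \<open>\<mu>\<close> itself on \<open>(0,\<infinity>)\<close> is recovered by dividing the integrable function by
  the positive factor \<open>min 1 t\<close>.\<close>
lemma density_measurable [measurable]: "(\<lambda>t. indicator {0<..} t * \<mu> t) \<in> borel_measurable borel"
proof -
  have "(\<lambda>t. indicator {0<..} t *\<^sub>R (min 1 t * \<mu> t)) \<in> borel_measurable borel"
    using borel_measurable_integrable[OF integrable_min[unfolded set_integrable_def]] by simp
  then have "(\<lambda>t. inverse (min 1 t) * (indicator {0<..} t *\<^sub>R (min 1 t * \<mu> t))) \<in> borel_measurable borel"
    by measurable
  also have "(\<lambda>t. inverse (min 1 t) * (indicator {0<..} t *\<^sub>R (min 1 t * \<mu> t)))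
      = (\<lambda>t. indicator {0<..} t * \<mu> t)"
    by (auto simp: indicator_def fun_eq_iff min_def)
  finally show ?thesis .
qed

abbreviation kernel :: "nat \<Rightarrow> real \<Rightarrow> real" where
  "kernel d \<equiv> jump_kernel d \<mu>"

lemma kernel_eq:
  "kernel d r = (\<integral>t. heat_kernel d r t * (indicator {0<..} t * \<mu> t) \<partial>lborel)"
  unfolding jump_kernel_def heat_kernel_def set_lebesgue_integral_def integral_mult_right_zero[symmetric]
  by (rule Bochner_Integration.integral_cong) (simp_all only: real_scaleR_def ac_simps)

lemma density_nonneg: "0 \<le> indicator {0<..} t * \<mu> t"
  by (cases "t > 0") (simp_all add: nonneg)

lemma integrable_kernel_integrand:
  assumes "r > 0"
  shows "integrable lborel (\<lambda>t. heat_kernel d r t * (indicator {0<..} t * \<mu> t))"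
proof -
  obtain C where C: "C \<ge> 0" "\<And>t. t > 0 \<Longrightarrow> heat_kernel d r t \<le> C * min 1 t"
    using heat_kernel_bound[OF assms] by blast
  have "integrable lborel (\<lambda>t. C * (indicator {0<..} t *\<^sub>R (min 1 t * \<mu> t)))"
    using integrable_min[unfolded set_integrable_def] by (rule integrable_mult_right)
  then show ?thesis
  proof (rule Bochner_Integration.integrable_bound)
    show "AE t in lborel. norm (heat_kernel d r t * (indicator {0<..} t * \<mu> t))
        \<le> norm (C * (indicator {0<..} t *\<^sub>R (min 1 t * \<mu> t)))"
    proof (intro always_eventually allI)
      fix t :: real
      show "norm (heat_kernel d r t * (indicator {0<..} t * \<mu> t))
        \<le> norm (C * (indicator {0<..} t *\<^sub>R (min 1 t * \<mu> t)))"
        using C mult_right_mono[OF C(2)[of t] nonneg[of t]]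
        by (cases "t > 0") (auto simp: heat_kernel_nonneg nonneg abs_mult mult.assoc)
    qed
  qed measurable
qed

lemma kernel_nonneg: "0 \<le> kernel d r"
  unfolding kernel_eq
  by (intro Bochner_Integration.integral_nonneg mult_nonneg_nonneg heat_kernel_nonneg density_nonneg)

lemma kernel_antimono:
  assumes "0 < r" "r \<le> s"
  shows "kernel d s \<le> kernel d r"
  unfolding kernel_eq
proof (intro Bochner_Integration.integral_mono integrable_kernel_integrand)
  show "heat_kernel d s t * (indicator {0<..} t * \<mu> t) \<le> heat_kernel d r t * (indicator {0<..} t * \<mu> t)" for t
    using heat_kernel_antimono[of r s t d] assms nonneg[of t]
    by (cases "t > 0") (auto intro: mult_right_mono)
qed (use assms in auto)

text \<open>Radii close to \<open>r\<close> exceed \<open>r / 2\<close>, so the integrand at radius \<open>r / 2\<close> dominates all of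
  theirs.\<close>
lemma kernel_tendsto:
  assumes "r > 0"
  shows "(kernel d \<longlongrightarrow> kernel d r) (at r)"
proof -
  have "(kernel d \<longlongrightarrow> kernel d r) (at r within {r/2<..})"
    unfolding tendsto_at_iff_sequentially comp_def
  proof (intro allI impI)
    fix X assume X: "\<forall>i. X i \<in> {r/2<..} - {r}" and lim: "X \<longlonglongrightarrow> r"
    show "(\<lambda>i. kernel d (X i)) \<longlonglongrightarrow> kernel d r"
      unfolding kernel_eq
    proof (rule integral_dominated_convergence
        [where w="\<lambda>t. heat_kernel d (r/2) t * (indicator {0<..} t * \<mu> t)"])
      show "AE t in lborel. (\<lambda>i. heat_kernel d (X i) t * (indicator {0<..} t * \<mu> t))
          \<longlonglongrightarrow> heat_kernel d r t * (indicator {0<..} t * \<mu> t)"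
      proof (intro always_eventually allI)
        fix t :: real
        show "(\<lambda>i. heat_kernel d (X i) t * (indicator {0<..} t * \<mu> t))
          \<longlonglongrightarrow> heat_kernel d r t * (indicator {0<..} t * \<mu> t)"
        proof (cases "t > 0")
          case True
          then show ?thesis
            unfolding heat_kernel_def by (intro tendsto_intros lim) auto
        qed simp
      qed
      show "AE t in lborel. norm (heat_kernel d (X i) t * (indicator {0<..} t * \<mu> t))
          \<le> heat_kernel d (r/2) t * (indicator {0<..} t * \<mu> t)" for i
      proof (intro always_eventually allI)
        fix t :: real
        show "norm (heat_kernel d (X i) t * (indicator {0<..} t * \<mu> t))
          \<le> heat_kernel d (r/2) t * (indicator {0<..} t * \<mu> t)"
          using heat_kernel_antimono[of "r/2" "X i" t d] X[rule_format, of i] assms nonneg[of t]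
          by (cases "t > 0") (auto simp: abs_mult heat_kernel_nonneg intro: mult_right_mono)
      qed
      show "integrable lborel (\<lambda>t. heat_kernel d (r/2) t * (indicator {0<..} t * \<mu> t))"
        using assms by (intro integrable_kernel_integrand) simp
    qed measurable
  qed
  moreover have "at r within {r/2<..} = at r"
    using assms by (intro at_within_open) auto
  ultimately show ?thesis
    by simp
qed

lemma kernel_measurable [measurable]: "kernel d \<in> borel_measurable borel"
  unfolding kernel_eq[abs_def] by measurable

text \<open>Tonelli moves the integration over \<open>h\<close> inside the mixture. This is the condition on Levy
  densities for \<open>j\<close>.\<close>
lemma integrable_truncated_kernel:
  "integrable lborel (\<lambda>h::'a::euclidean_space. min 1 ((norm h)\<^sup>2) * kernel DIM('a) (norm h))"
proof (rule integrableI_nonneg)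
  let ?m = "\<lambda>t. indicator {0<..} t * \<mu> t"
  have "(\<integral>\<^sup>+(h::'a). min 1 ((norm h)\<^sup>2) * kernel DIM('a) (norm h) \<partial>lborel)
      \<le> (\<integral>\<^sup>+(h::'a). \<integral>\<^sup>+t. (min 1 ((norm h)\<^sup>2) * heat_kernel DIM('a) (norm h) t) * ennreal (?m t) \<partial>lborel \<partial>lborel)"
  proof (intro nn_integral_mono)
    fix h :: 'a
    show "ennreal (min 1 ((norm h)\<^sup>2) * kernel DIM('a) (norm h))
      \<le> (\<integral>\<^sup>+t. (min 1 ((norm h)\<^sup>2) * heat_kernel DIM('a) (norm h) t) * ennreal (?m t) \<partial>lborel)"
    \<comment> \<open>At \<open>h = 0\<close> the mixture may diverge, but the factor \<open>min 1 ((norm h)\<^sup>2)\<close> vanishes.\<close>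
    proof (cases "h = 0")
      case False
      have "ennreal (min 1 ((norm h)\<^sup>2) * kernel DIM('a) (norm h))
          = ennreal (min 1 ((norm h)\<^sup>2)) * (\<integral>\<^sup>+t. ennreal (heat_kernel DIM('a) (norm h) t * ?m t) \<partial>lborel)"
        unfolding kernel_eq using False
        by (subst nn_integral_eq_integral[OF integrable_kernel_integrand])
          (auto simp: heat_kernel_nonneg density_nonneg ennreal_mult Bochner_Integration.integral_nonneg)
      also have "\<dots> = (\<integral>\<^sup>+t. (min 1 ((norm h)\<^sup>2) * heat_kernel DIM('a) (norm h) t) * ennreal (?m t) \<partial>lborel)"
        by (subst nn_integral_cmult[symmetric])
          (auto simp: ennreal_mult heat_kernel_nonneg density_nonneg mult.assoc)
      finally show ?thesis
        by simp
    qed simp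
  qed
  also have "\<dots> = (\<integral>\<^sup>+t. \<integral>\<^sup>+(h::'a). (min 1 ((norm h)\<^sup>2) * heat_kernel DIM('a) (norm h) t) * ennreal (?m t) \<partial>lborel \<partial>lborel)"
    by (intro lborel_pair.Fubini') measurable
  also have "\<dots> = (\<integral>\<^sup>+t. (\<integral>\<^sup>+(h::'a). min 1 ((norm h)\<^sup>2) * heat_kernel DIM('a) (norm h) t \<partial>lborel) * ennreal (?m t) \<partial>lborel)"
    by (intro nn_integral_cong nn_integral_multc) measurable
  also have "\<dots> \<le> (\<integral>\<^sup>+t. ennreal (2 * real DIM('a) * (indicator {0<..} t *\<^sub>R (min 1 t * \<mu> t))) \<partial>lborel)"
  proof (intro nn_integral_mono)
    fix t :: real
    show "(\<integral>\<^sup>+(h::'a). min 1 ((norm h)\<^sup>2) * heat_kernel DIM('a) (norm h) t \<partial>lborel) * ennreal (?m t)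
        \<le> ennreal (2 * real DIM('a) * (indicator {0<..} t *\<^sub>R (min 1 t * \<mu> t)))"
    proof (cases "t > 0")
      case True
      then show ?thesis
        using mult_right_mono[OF nn_integral_heat_kernel_truncated[OF True, where 'a='a], of "ennreal (\<mu> t)"]
        by (simp add: nonneg ennreal_mult[symmetric] mult.assoc)
    qed simp
  qed
  also have "\<dots> < \<infinity>"
    using integrable_mult_right[OF integrable_min[unfolded set_integrable_def], of "2 * real DIM('a)"]
    by (subst nn_integral_eq_integral) (auto simp: indicator_def nonneg)
  finally show "(\<integral>\<^sup>+(h::'a). min 1 ((norm h)\<^sup>2) * kernel DIM('a) (norm h) \<partial>lborel) < \<infinity>" .
qed (measurable, simp add: kernel_nonneg)

text \<open>Freezing the kernel at its value at radius \<open>\<rho>\<close> removes the singularity, and outside the ball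
  of radius \<open>\<rho>\<close> the weight \<open>min 1 ((norm h)\<^sup>2)\<close> is bounded below.\<close>
lemma integrable_flattened_kernel:
  assumes "\<rho> > 0"
  shows "integrable lborel (\<lambda>h::'a::euclidean_space. kernel DIM('a) (max \<rho> (norm h)))"
proof -
  define m where "m = min 1 (\<rho>\<^sup>2)"
  have "m > 0"
    using assms by (simp add: m_def)
  have "integrable lborel (\<lambda>h::'a. indicator (ball 0 \<rho>) h * kernel DIM('a) \<rho>
      + (min 1 ((norm h)\<^sup>2) * kernel DIM('a) (norm h)) / m)"
    using emeasure_lborel_ball_finite[of "0::'a" \<rho>]
    by (intro Bochner_Integration.integrable_add integrable_divide_zero integrable_truncated_kernel
        integrable_mult_left integrable_real_indicator) (auto simp: less_top)
  then show ?thesis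
  proof (rule Bochner_Integration.integrable_bound)
    show "AE h::'a in lborel. norm (kernel DIM('a) (max \<rho> (norm h)))
        \<le> norm (indicator (ball 0 \<rho>) h * kernel DIM('a) \<rho>
            + (min 1 ((norm h)\<^sup>2) * kernel DIM('a) (norm h)) / m)"
    proof (intro always_eventually allI)
      fix h :: 'a
      let ?w = "(min 1 ((norm h)\<^sup>2) * kernel DIM('a) (norm h)) / m"
      have "0 \<le> ?w"
        using \<open>m > 0\<close> by (simp add: kernel_nonneg)
      moreover have "kernel DIM('a) (norm h) \<le> ?w" if "\<rho> \<le> norm h"
      proof -
        have "m \<le> min 1 ((norm h)\<^sup>2)"
          using that assms unfolding m_def by (intro min.mono power_mono) auto
        then have "m * kernel DIM('a) (norm h) \<le> min 1 ((norm h)\<^sup>2) * kernel DIM('a) (norm h)"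
          by (intro mult_right_mono kernel_nonneg)
        then show ?thesis
          using \<open>m > 0\<close> by (simp add: field_simps)
      qed
      moreover have "\<bar>m\<bar> = m"
        using \<open>m > 0\<close> by simp
      ultimately show "norm (kernel DIM('a) (max \<rho> (norm h)))
          \<le> norm (indicator (ball 0 \<rho>) h * kernel DIM('a) \<rho> + ?w)"
        by (cases "norm h < \<rho>") (auto simp: kernel_nonneg max_def)
    qed
  qed measurable
qed

text \<open>The dilated kernel is the dominating function for small translates of the flattened one; its
  integrability is a linear change of variables.\<close>
lemma integrable_flattened_kernel_half:
  assumes "\<rho> > 0"
  shows "integrable lborel (\<lambda>h::'a::euclidean_space. kernel DIM('a) (max \<rho> (norm h / 2)))"
proof -
  have "integrable (density (distr lborel borel (\<lambda>x::'a. 0 + 2 *\<^sub>R x)) (\<lambda>_. ennreal (\<bar>2\<bar> ^ DIM('a))))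
      (\<lambda>h::'a. kernel DIM('a) (max \<rho> (norm h / 2)))"
    using integrable_flattened_kernel[OF assms, where 'a='a]
    by (subst integrable_density) (auto simp: integrable_distr_eq)
  then show ?thesis
    using lborel_affine[of 2 "0::'a"] by (simp del: abs_numeral)
qed

text \<open>The singular part vanishes for \<open>norm h \<ge> \<rho>\<close> and lies between 0 and the kernel otherwise, while
  \<open>\<rho> \<le> 1\<close> makes the minimum equal to \<open>(norm h)\<^sup>2\<close> on its support. At \<open>h = 0\<close>, where the kernel has no
  meaningful value, both sides are 0.\<close>
lemma kernel_singular_part:
  fixes h :: "'a::euclidean_space"
  assumes "0 < \<rho>" "\<rho> \<le> 1"
  shows "norm ((norm h)\<^sup>2 * (kernel DIM('a) (norm h) - kernel DIM('a) (max \<rho> (norm h))))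
    \<le> min 1 ((norm h)\<^sup>2) * kernel DIM('a) (norm h)"
proof (cases "h = 0 \<or> \<rho> \<le> norm h")
  case True
  then show ?thesis
    by (auto simp: max_def kernel_nonneg)
next
  case False
  then have "kernel DIM('a) \<rho> \<le> kernel DIM('a) (norm h)"
    by (intro kernel_antimono) auto
  moreover have "(norm h)\<^sup>2 \<le> 1"
    using False assms by (intro power_le_one) auto
  ultimately show ?thesis
    using False by (auto simp: max_def abs_mult kernel_nonneg intro!: mult_left_mono)
qed

lemma integrable_kernel_singular_part:
  assumes "0 < \<rho>" "\<rho> \<le> 1"
  shows "integrable lborel (\<lambda>h::'a::euclidean_space. (norm h)\<^sup>2 *
    (kernel DIM('a) (norm h) - kernel DIM('a) (max \<rho> (norm h))))"
proof (rule Bochner_Integration.integrable_bound[OF integrable_truncated_kernel])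
  show "AE h::'a in lborel. norm ((norm h)\<^sup>2 * (kernel DIM('a) (norm h) - kernel DIM('a) (max \<rho> (norm h))))
      \<le> norm (min 1 ((norm h)\<^sup>2) * kernel DIM('a) (norm h))"
    by (intro always_eventually allI order.trans[OF kernel_singular_part[OF assms]]) simp
qed measurable

lemma flattened_kernel_continuous:
  assumes "\<rho> > 0"
  shows "continuous_on UNIV (\<lambda>h::'a::euclidean_space. kernel d (max \<rho> (norm h)))"
proof -
  have "continuous_on {0<..} (kernel d)"
    using kernel_tendsto[of _ d] by (auto simp: continuous_on_def intro: tendsto_within_subset)
  then show ?thesis
    by (rule continuous_on_compose2) (use assms in \<open>auto intro!: continuous_intros\<close>)
qed

text \<open>If \<open>norm z \<ge> 2 * \<rho>\<close>, then \<open>norm (z + u) \<ge> norm z - \<rho> \<ge> norm z / 2\<close>; otherwise the right-hand side is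
  the maximal value, taken at radius \<open>\<rho>\<close>.\<close>
lemma flattened_kernel_shift_le:
  fixes z u :: "'a::euclidean_space"
  assumes "\<rho> > 0" "norm u < \<rho>"
  shows "kernel d (max \<rho> (norm (z + u))) \<le> kernel d (max \<rho> (norm z / 2))"
proof (rule kernel_antimono)
  have "norm z \<le> norm (z + u) + norm u"
    using norm_triangle_ineq4[of "z + u" u] by simp
  then show "max \<rho> (norm z / 2) \<le> max \<rho> (norm (z + u))"
    using assms by (auto simp: max_def)
qed (use assms in auto)

end

section \<open>Translations and reflections of Lebesgue measure\<close>

context
  fixes x :: "'a::euclidean_space" and s :: real
  assumes s: "s \<in> {1, -1}"
begin

lemma isometry_measurable: "(\<lambda>h. x + s *\<^sub>R h) \<in> lebesgue \<rightarrow>\<^sub>M lebesgue"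
proof -
  have "(\<lambda>h::'a. x + (\<Sum>j\<in>Basis. (s * (h \<bullet> j)) *\<^sub>R j)) \<in> lebesgue \<rightarrow>\<^sub>M lebesgue"
    using s by (intro lebesgue_affine_measurable) auto
  also have "(\<lambda>h::'a. x + (\<Sum>j\<in>Basis. (s * (h \<bullet> j)) *\<^sub>R j)) = (\<lambda>h. x + s *\<^sub>R h)"
    by (simp add: euclidean_representation flip: scaleR_scaleR scaleR_sum_right)
  finally show ?thesis .
qed

lemma lebesgue_isometry: "distr lebesgue lebesgue (\<lambda>h. x + s *\<^sub>R h) = lebesgue"
proof -
  have "lebesgue = density (distr lebesgue lebesgue (\<lambda>h. x + (\<Sum>j\<in>Basis. (s * (h \<bullet> j)) *\<^sub>R j)))
      (\<lambda>_. ennreal (\<Prod>j\<in>(Basis::'a set). \<bar>s\<bar>))"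
    using s by (intro lebesgue_affine_euclidean) auto
  also have "(\<lambda>h::'a. x + (\<Sum>j\<in>Basis. (s * (h \<bullet> j)) *\<^sub>R j)) = (\<lambda>h. x + s *\<^sub>R h)"
    by (simp add: euclidean_representation flip: scaleR_scaleR scaleR_sum_right)
  also have "(\<Prod>j\<in>(Basis::'a set). \<bar>s\<bar>) = 1"
    using s by auto
  finally show ?thesis
    by (simp add: density_1)
qed

lemma isometry_compose_measurable:
  fixes f :: "'a \<Rightarrow> real"
  assumes "f \<in> borel_measurable lebesgue"
  shows "(\<lambda>h. f (x + s *\<^sub>R h)) \<in> borel_measurable lebesgue"
  using measurable_compose[OF isometry_measurable assms] .

lemma AE_isometry:
  assumes "AE y in lebesgue. P y"
  shows "AE h in lebesgue. P (x + s *\<^sub>R h)"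
  by (rule AE_distrD[OF isometry_measurable], subst lebesgue_isometry, rule assms)

lemma integral_isometry:
  fixes f :: "'a \<Rightarrow> real"
  assumes "f \<in> borel_measurable lebesgue"
  shows "(LINT h|lebesgue. f (x + s *\<^sub>R h)) = (LINT y|lebesgue. f y)"
  using integral_distr[OF isometry_measurable assms] by (simp add: lebesgue_isometry)

end

section \<open>Integrals of second differences\<close>

lemma in_LinfE:
  assumes "in_Linf f"
  obtains C where "C \<ge> 0" "f \<in> borel_measurable lebesgue" "AE x in lebesgue. \<bar>f x\<bar> \<le> C"
proof -
  obtain C where C: "f \<in> borel_measurable lebesgue" "AE x in lebesgue. \<bar>f x\<bar> \<le> C"
    using assms by (auto simp: in_Linf_def)
  then have "AE x in lebesgue. \<bar>f x\<bar> \<le> max 0 C"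
    by auto
  then show thesis
    using C(1) that[of "max 0 C"] by simp
qed

lemma integrable_Linf_shift_times:
  fixes f k :: "'a::euclidean_space \<Rightarrow> real"
  assumes "in_Linf f" "s \<in> {1, -1}" "integrable lebesgue k"
  shows "integrable lebesgue (\<lambda>h. f (x + s *\<^sub>R h) * k h)"
proof -
  obtain C where C: "C \<ge> 0" "f \<in> borel_measurable lebesgue" "AE x in lebesgue. \<bar>f x\<bar> \<le> C"
    using assms(1) by (rule in_LinfE)
  have "integrable lebesgue (\<lambda>h. C * k h)"
    using assms(3) by (rule integrable_mult_right)
  then show ?thesis
  proof (rule Bochner_Integration.integrable_bound)
    show "AE h in lebesgue. norm (f (x + s *\<^sub>R h) * k h) \<le> norm (C * k h)"
      using AE_isometry[OF assms(2) C(3)]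
      by eventually_elim (use C(1) in \<open>auto simp: abs_mult intro: mult_right_mono\<close>)
    show "(\<lambda>h. f (x + s *\<^sub>R h) * k h) \<in> borel_measurable lebesgue"
      using isometry_compose_measurable[OF assms(2) C(2)] borel_measurable_integrable[OF assms(3)]
      by (rule borel_measurable_times)
  qed
qed

text \<open>\<open>f\<close> may be discontinuous everywhere. Substituting \<open>x + s *\<^sub>R h = a + z\<close> puts the
  dependence on \<open>x\<close> into the continuous factor \<open>k\<close>, where evenness absorbs the sign \<open>s\<close>, and \<open>w\<close>
  dominates the integrands uniformly in \<open>x\<close>.\<close>
lemma convolution_tendsto:
  fixes f k w :: "'a::euclidean_space \<Rightarrow> real"
  assumes f: "in_Linf f"
    and s: "s \<in> {1, -1}"
    and k_cont: "continuous_on UNIV k"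
    and k_even: "\<And>h. k (- h) = k h"
    and \<rho>: "\<rho> > 0"
    and dom: "\<And>z u. norm u < \<rho> \<Longrightarrow> \<bar>k (z + u)\<bar> \<le> w z"
    and w: "integrable lebesgue w"
  shows "((\<lambda>x. LINT h|lebesgue. f (x + s *\<^sub>R h) * k h) \<longlongrightarrow>
    (LINT h|lebesgue. f (a + s *\<^sub>R h) * k h)) (at a)"
proof -
  obtain C where C: "C \<ge> 0" "f \<in> borel_measurable lebesgue" "AE x in lebesgue. \<bar>f x\<bar> \<le> C"
    using f by (rule in_LinfE)
  have k_meas: "(\<lambda>y. k (y + b)) \<in> borel_measurable lebesgue" for b
  proof -
    have "continuous_on UNIV (\<lambda>y. k (y + b))"
      by (rule continuous_on_compose2[OF k_cont]) (auto intro!: continuous_intros)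
    then show ?thesis
      by (intro measurable_completion) (simp add: borel_measurable_continuous_onI)
  qed
  have shift: "(LINT h|lebesgue. f (x + s *\<^sub>R h) * k h)
      = (LINT z|lebesgue. f (a + z) * k (z + (a - x)))" for x
  proof -
    define F where "F y = f y * k (y + - x)" for y
    have F_meas: "F \<in> borel_measurable lebesgue"
      unfolding F_def[abs_def] by (intro borel_measurable_times C(2) k_meas)
    have "(LINT h|lebesgue. f (x + s *\<^sub>R h) * k h) = (LINT h|lebesgue. F (x + s *\<^sub>R h))"
      using s k_even by (auto simp: F_def)
    also have "\<dots> = (LINT z|lebesgue. F (a + 1 *\<^sub>R z))"
      using integral_isometry[OF s F_meas] integral_isometry[of 1 F a] F_meas by simp
    finally show ?thesis
      by (simp add: F_def algebra_simps)
  qed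
  have "((\<lambda>x. LINT z|lebesgue. f (a + z) * k (z + (a - x))) \<longlongrightarrow>
    (LINT z|lebesgue. f (a + z) * k (z + (a - a)))) (at a within ball a \<rho>)"
    unfolding tendsto_at_iff_sequentially comp_def
  proof (intro allI impI)
    fix X assume X: "\<forall>i. X i \<in> ball a \<rho> - {a}" and lim: "X \<longlonglongrightarrow> a"
    have f_meas: "(\<lambda>z. f (a + z)) \<in> borel_measurable lebesgue"
      using isometry_compose_measurable[of 1 f a] C(2) by simp
    show "(\<lambda>i. LINT z|lebesgue. f (a + z) * k (z + (a - X i))) \<longlonglongrightarrow>
        (LINT z|lebesgue. f (a + z) * k (z + (a - a)))"
    proof (rule integral_dominated_convergence[where w="\<lambda>z. C * w z"])
      show "AE z in lebesgue. (\<lambda>i. f (a + z) * k (z + (a - X i))) \<longlonglongrightarrow> f (a + z) * k (z + (a - a))"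
        by (intro always_eventually allI tendsto_intros lim continuous_on_tendsto_compose[OF k_cont]) auto
      show "AE z in lebesgue. norm (f (a + z) * k (z + (a - X i))) \<le> C * w z" for i
      proof -
        have "norm (a - X i) < \<rho>"
          using X[rule_format, of i] by (simp add: dist_norm)
        then show ?thesis
          using AE_isometry[of 1 _ a, OF _ C(3)]
          by (auto simp: abs_mult elim!: eventually_mono intro!: mult_mono dom C(1))
      qed
      show "integrable lebesgue (\<lambda>z. C * w z)"
        using w by (rule integrable_mult_right)
    qed (intro borel_measurable_times f_meas k_meas)+
  qed
  moreover have "at a within ball a \<rho> = at a"
    using \<rho> by (intro at_within_open) auto
  ultimately show ?thesis
    by (simp only: shift)
qed

lemma second_diff_measurable:
  assumes "f \<in> borel_measurable lebesgue"
  shows "(\<lambda>h. second_diff h f x) \<in> borel_measurable lebesgue"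
  using isometry_compose_measurable[of 1 f x] isometry_compose_measurable[of "-1" f x] assms
  unfolding second_diff_def by simp

lemma second_diff_integral_split:
  assumes "in_Linf f" "integrable lebesgue k"
  shows "integrable lebesgue (\<lambda>h. second_diff h f x * k h)"
    and "(LINT h|lebesgue. second_diff h f x * k h)
      = (LINT h|lebesgue. f (x + 1 *\<^sub>R h) * k h) + (LINT h|lebesgue. f (x + (-1) *\<^sub>R h) * k h)
        - 2 * f x * (LINT h|lebesgue. k h)"
proof -
  have eq: "(\<lambda>h. second_diff h f x * k h)
      = (\<lambda>h. f (x + 1 *\<^sub>R h) * k h + f (x + (-1) *\<^sub>R h) * k h - 2 * f x * k h)"
    by (simp add: second_diff_def fun_eq_iff algebra_simps)
  have i: "integrable lebesgue (\<lambda>h. f (x + s *\<^sub>R h) * k h)" if "s \<in> {1, -1}" for s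
    using assms that by (intro integrable_Linf_shift_times)
  have i0: "integrable lebesgue (\<lambda>h. 2 * f x * k h)"
    using assms(2) by (rule integrable_mult_right)
  show "integrable lebesgue (\<lambda>h. second_diff h f x * k h)"
    unfolding eq by (intro Bochner_Integration.integrable_diff Bochner_Integration.integrable_add i i0) auto
  show "(LINT h|lebesgue. second_diff h f x * k h)
      = (LINT h|lebesgue. f (x + 1 *\<^sub>R h) * k h) + (LINT h|lebesgue. f (x + (-1) *\<^sub>R h) * k h)
        - 2 * f x * (LINT h|lebesgue. k h)"
    unfolding eq
    by (simp only: Bochner_Integration.integral_diff[OF Bochner_Integration.integrable_add[OF i i] i0]
        Bochner_Integration.integral_add[OF i i] integral_mult_right_zero insertI1 insertI2 simp_thms)
qed

lemma second_diff_integral_far_tendsto: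
  fixes f k w :: "'a::euclidean_space \<Rightarrow> real"
  assumes "in_Linf f" "continuous_on UNIV k" "\<And>h. k (- h) = k h" "\<rho> > 0"
    and "\<And>z u. norm u < \<rho> \<Longrightarrow> \<bar>k (z + u)\<bar> \<le> w z" "integrable lebesgue w"
    and "integrable lebesgue k" "isCont f a"
  shows "((\<lambda>x. LINT h|lebesgue. second_diff h f x * k h) \<longlongrightarrow>
    (LINT h|lebesgue. second_diff h f a * k h)) (at a)"
  unfolding second_diff_integral_split(2)[OF assms(1,7)]
proof (intro tendsto_diff tendsto_add)
  show "((\<lambda>x. LINT h|lebesgue. f (x + 1 *\<^sub>R h) * k h) \<longlongrightarrow>
      (LINT h|lebesgue. f (a + 1 *\<^sub>R h) * k h)) (at a)"
    by (rule convolution_tendsto[OF assms(1) _ assms(2-6)]) simp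
  show "((\<lambda>x. LINT h|lebesgue. f (x + (-1) *\<^sub>R h) * k h) \<longlongrightarrow>
      (LINT h|lebesgue. f (a + (-1) *\<^sub>R h) * k h)) (at a)"
    by (rule convolution_tendsto[OF assms(1) _ assms(2-6)]) simp
  show "((\<lambda>x. 2 * f x * (LINT h|lebesgue. k h)) \<longlongrightarrow> 2 * f a * (LINT h|lebesgue. k h)) (at a)"
    using assms(8) unfolding isCont_def by (intro tendsto_mult tendsto_const)
qed

text \<open>Here \<open>k\<close> may have a nonintegrable singularity at the origin. The quadratic bound on the
  second differences compensates it uniformly in \<open>x\<close>, and for \<open>h\<close> in the support of \<open>k\<close> the points
  \<open>x \<plusminus> h\<close> remain in the ball of radius \<open>2 * \<rho>\<close>, where \<open>f\<close> is continuous.\<close>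
lemma second_diff_integral_near:
  fixes f k :: "'a::euclidean_space \<Rightarrow> real"
  assumes f_meas: "f \<in> borel_measurable lebesgue"
    and f_cont: "continuous_on (ball a (2 * \<rho>)) f"
    and f_bound: "\<And>x h. x \<in> ball a \<rho> \<Longrightarrow> norm h < \<rho> \<Longrightarrow> \<bar>second_diff h f x\<bar> \<le> M * (norm h)\<^sup>2"
    and k_meas: "k \<in> borel_measurable lebesgue"
    and k_supp: "\<And>h. \<rho> \<le> norm h \<Longrightarrow> k h = 0"
    and k_int: "integrable lebesgue (\<lambda>h. (norm h)\<^sup>2 * k h)"
    and \<rho>: "\<rho> > 0"
  shows "\<And>x. x \<in> ball a \<rho> \<Longrightarrow> integrable lebesgue (\<lambda>h. second_diff h f x * k h)"
    and "((\<lambda>x. LINT h|lebesgue. second_diff h f x * k h) \<longlongrightarrow>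
      (LINT h|lebesgue. second_diff h f a * k h)) (at a)"
proof -
  have dom: "norm (second_diff h f x * k h) \<le> M * norm ((norm h)\<^sup>2 * k h)" if "x \<in> ball a \<rho>" for x h
  proof (cases "norm h < \<rho>")
    case True
    show ?thesis
      using mult_right_mono[OF f_bound[OF that True], of "\<bar>k h\<bar>"] by (simp add: abs_mult mult.assoc)
  qed (simp add: k_supp)
  have w_int: "integrable lebesgue (\<lambda>h. M * norm ((norm h)\<^sup>2 * k h))"
    by (intro integrable_mult_right integrable_norm k_int)
  have meas: "(\<lambda>h. second_diff h f x * k h) \<in> borel_measurable lebesgue" for x
    by (intro borel_measurable_times second_diff_measurable f_meas k_meas)
  show "integrable lebesgue (\<lambda>h. second_diff h f x * k h)" if "x \<in> ball a \<rho>" for x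
    by (rule Bochner_Integration.integrable_bound[OF w_int meas])
      (use dom[OF that] in \<open>auto intro!: always_eventually order.trans[OF _ abs_ge_self]\<close>)
  have "((\<lambda>x. LINT h|lebesgue. second_diff h f x * k h) \<longlongrightarrow>
      (LINT h|lebesgue. second_diff h f a * k h)) (at a within ball a \<rho>)"
    unfolding tendsto_at_iff_sequentially comp_def
  proof (intro allI impI)
    fix X assume X: "\<forall>i. X i \<in> ball a \<rho> - {a}" and lim: "X \<longlonglongrightarrow> a"
    have pointwise: "(\<lambda>i. second_diff h f (X i) * k h) \<longlonglongrightarrow> second_diff h f a * k h" for h
    proof (cases "norm h < \<rho>")
      case True
      have near: "(\<lambda>i. f (X i + v)) \<longlonglongrightarrow> f (a + v)" if "norm v < \<rho>" for v
      proof (rule continuous_on_tendsto_compose[OF f_cont])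
        show "(\<lambda>i. X i + v) \<longlonglongrightarrow> a + v"
          by (intro tendsto_intros lim)
        show "a + v \<in> ball a (2 * \<rho>)"
          using that \<rho> by (simp add: dist_norm)
        show "\<forall>\<^sub>F i in sequentially. X i + v \<in> ball a (2 * \<rho>)"
        proof (intro always_eventually allI)
          fix i
          have "dist a (X i + v) \<le> dist a (X i) + norm v"
            using dist_triangle[of a "X i + v" "X i"] by (simp add: dist_norm)
          then show "X i + v \<in> ball a (2 * \<rho>)"
            using X[rule_format, of i] that by simp
        qed
      qed
      show ?thesis
        unfolding second_diff_def
        using near[of h] near[of "- h"] near[of 0] True \<rho> by (intro tendsto_intros) auto
    qed (simp add: k_supp)
    show "(\<lambda>i. LINT h|lebesgue. second_diff h f (X i) * k h) \<longlonglongrightarrow>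
        (LINT h|lebesgue. second_diff h f a * k h)"
      by (rule integral_dominated_convergence[OF meas meas w_int])
        (use pointwise dom X in \<open>auto intro!: always_eventually\<close>)
  qed
  then show "((\<lambda>x. LINT h|lebesgue. second_diff h f x * k h) \<longlongrightarrow>
      (LINT h|lebesgue. second_diff h f a * k h)) (at a)"
    using \<rho> at_within_open[of a "ball a \<rho>"] by simp
qed

lemma Z_b_loc_second_diff_bound:
  assumes "f \<in> Z_b_loc \<Omega>" "compact K" "K \<subseteq> \<Omega>"
  obtains R M where "R > 0"
    "\<And>x h. x \<in> K \<Longrightarrow> norm h < R \<Longrightarrow> \<bar>second_diff h f x\<bar> \<le> M * (norm h)\<^sup>2"
proof -
  obtain R L where R: "R > 0" and L: "bounded (L ` K)"
    "\<forall>x\<in>K. \<forall>h\<in>ball 0 R. \<bar>second_diff h f x\<bar> \<le> L x * (norm h)\<^sup>2"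
    using assms by (auto simp: Z_b_loc_def Z_b_def)
  obtain M where M: "\<And>x. x \<in> K \<Longrightarrow> \<bar>L x\<bar> \<le> M"
    using L(1) by (auto simp: bounded_iff)
  show thesis
  proof (rule that[OF R])
    fix x h :: 'a
    assume "x \<in> K" "norm h < R"
    then have "\<bar>second_diff h f x\<bar> \<le> L x * (norm h)\<^sup>2"
      using L(2) by simp
    also have "\<dots> \<le> M * (norm h)\<^sup>2"
      using M[OF \<open>x \<in> K\<close>] by (intro mult_right_mono) auto
    finally show "\<bar>second_diff h f x\<bar> \<le> M * (norm h)\<^sup>2" .
  qed
qed

section \<open>Continuity of the potential\<close>

text \<open>The kernel is the sum of its singular part, treated by \<open>second_diff_integral_near\<close>, and the
  flattened kernel, treated by \<open>second_diff_integral_far_tendsto\<close>.\<close>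
lemma (in levy_density) second_diff_kernel_integral:
  fixes f :: "'a::euclidean_space \<Rightarrow> real"
  assumes f: "in_Linf f" "f \<in> Z_b_loc \<Omega>" "continuous_on \<Omega> f"
    and \<Omega>: "open \<Omega>" "a \<in> \<Omega>"
  shows "integrable lebesgue (\<lambda>h. second_diff h f a * kernel DIM('a) (norm h))"
    and "((\<lambda>x. LINT h|lebesgue. second_diff h f x * kernel DIM('a) (norm h)) \<longlongrightarrow>
      (LINT h|lebesgue. second_diff h f a * kernel DIM('a) (norm h))) (at a)"
proof -
  obtain e where e: "e > 0" "cball a e \<subseteq> \<Omega>"
    using \<Omega> open_contains_cball by blast
  obtain R M where R: "R > 0"
    and M: "\<And>x h. x \<in> cball a e \<Longrightarrow> norm h < R \<Longrightarrow> \<bar>second_diff h f x\<bar> \<le> M * (norm h)\<^sup>2"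
    using Z_b_loc_second_diff_bound[OF f(2) _ e(2)] by (metis compact_cball)
  \<comment> \<open>\<open>2 * \<rho> \<le> e\<close> keeps \<open>x \<plusminus> h\<close> in \<open>\<Omega>\<close>, \<open>\<rho> \<le> R\<close> gives the quadratic bound, and \<open>\<rho> \<le> 1\<close> makes
    \<open>min 1 ((norm h)\<^sup>2)\<close> quadratic on the support of \<open>n\<close>.\<close>
  define \<rho> where "\<rho> = min (min 1 R) (e / 2)"
  have \<rho>: "0 < \<rho>" "\<rho> \<le> 1" "\<rho> \<le> R" "2 * \<rho> \<le> e"
    using e R by (auto simp: \<rho>_def)
  define k where "k h = kernel DIM('a) (max \<rho> (norm h))" for h :: 'a
  define n where "n h = kernel DIM('a) (norm h) - k h" for h :: 'a
  have k_meas: "k \<in> borel_measurable lborel"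
    unfolding k_def[abs_def] by measurable
  have n_meas: "n \<in> borel_measurable lborel"
    unfolding n_def[abs_def] k_def[abs_def] by measurable
  have f_meas: "f \<in> borel_measurable lebesgue"
    using f(1) by (simp add: in_Linf_def)
  have "ball a (2 * \<rho>) \<subseteq> \<Omega>"
    using e \<rho> by (meson ball_subset_cball order.trans subset_ball)
  then have f_cont: "continuous_on (ball a (2 * \<rho>)) f"
    using f(3) continuous_on_subset by blast
  have f_bound: "\<bar>second_diff h f x\<bar> \<le> M * (norm h)\<^sup>2" if "x \<in> ball a \<rho>" "norm h < \<rho>" for x h
    using that \<rho> by (intro M) auto
  have n_supp: "n h = 0" if "\<rho> \<le> norm h" for h
    using that by (simp add: n_def k_def max_def)
  have n_int: "integrable lebesgue (\<lambda>h. (norm h)\<^sup>2 * n h)"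
    using integrable_kernel_singular_part[OF \<rho>(1,2), where 'a='a] n_meas
    by (subst integrable_completion) (auto simp: n_def k_def)
  note near_thms = second_diff_integral_near
    [where M=M, OF f_meas f_cont _ measurable_completion[OF n_meas] _ n_int \<rho>(1)]
  have near_int: "integrable lebesgue (\<lambda>h. second_diff h f x * n h)" if "x \<in> ball a \<rho>" for x
    by (rule near_thms(1)[OF _ _ that]) (use f_bound n_supp in blast)+
  have near: "((\<lambda>x. LINT h|lebesgue. second_diff h f x * n h) \<longlongrightarrow>
      (LINT h|lebesgue. second_diff h f a * n h)) (at a)"
    by (rule near_thms(2)) (use f_bound n_supp in blast)+
  have k_int: "integrable lebesgue k"
    using integrable_flattened_kernel[OF \<rho>(1), where 'a='a] k_meas
    by (subst integrable_completion) (auto simp: k_def[abs_def])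
  have w_int: "integrable lebesgue (\<lambda>h::'a. kernel DIM('a) (max \<rho> (norm h / 2)))"
    using integrable_flattened_kernel_half[OF \<rho>(1), where 'a='a] 
    by (subst integrable_completion) auto
  have far_int: "integrable lebesgue (\<lambda>h. second_diff h f x * k h)" for x
    by (rule second_diff_integral_split(1)[OF f(1) k_int])
  have "isCont f a"
    using f(3) \<Omega> continuous_on_eq_continuous_at by blast
  then have far: "((\<lambda>x. LINT h|lebesgue. second_diff h f x * k h) \<longlongrightarrow>
      (LINT h|lebesgue. second_diff h f a * k h)) (at a)"
    using flattened_kernel_shift_le[OF \<rho>(1), of _ "DIM('a)"] flattened_kernel_continuous[OF \<rho>(1)]
    by (intro second_diff_integral_far_tendsto[OF f(1) _ _ \<rho>(1) _ w_int k_int])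
      (auto simp: k_def[abs_def] kernel_nonneg)
  have split: "second_diff h f x * kernel DIM('a) (norm h)
      = second_diff h f x * n h + second_diff h f x * k h" for x h
    by (simp add: n_def algebra_simps)
  have int: "integrable lebesgue (\<lambda>h. second_diff h f x * kernel DIM('a) (norm h))"
    and eq: "(LINT h|lebesgue. second_diff h f x * kernel DIM('a) (norm h))
      = (LINT h|lebesgue. second_diff h f x * n h) + (LINT h|lebesgue. second_diff h f x * k h)"
    if "x \<in> ball a \<rho>" for x
    unfolding split using near_int[OF that] far_int by simp_all
  show "integrable lebesgue (\<lambda>h. second_diff h f a * kernel DIM('a) (norm h))"
    using \<rho>(1) by (intro int) simp
  have "((\<lambda>x. (LINT h|lebesgue. second_diff h f x * n h) + (LINT h|lebesgue. second_diff h f x * k h)) \<longlongrightarrow>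
      (LINT h|lebesgue. second_diff h f a * n h) + (LINT h|lebesgue. second_diff h f a * k h)) (at a)"
    by (intro tendsto_add near far)
  then have "((\<lambda>x. LINT h|lebesgue. second_diff h f x * kernel DIM('a) (norm h)) \<longlongrightarrow>
      (LINT h|lebesgue. second_diff h f a * n h) + (LINT h|lebesgue. second_diff h f a * k h)) (at a)"
    by (rule Lim_transform_within_open[where s="ball a \<rho>"]) (use eq \<rho>(1) in auto)
  then show "((\<lambda>x. LINT h|lebesgue. second_diff h f x * kernel DIM('a) (norm h)) \<longlongrightarrow>
      (LINT h|lebesgue. second_diff h f a * kernel DIM('a) (norm h))) (at a)"
    by (simp only: eq[of a] centre_in_ball \<rho>(1))
qed

lemma complete_bernstein_levy_density:
  assumes "complete_bernstein \<Phi> \<mu>"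
  shows "levy_density \<mu>"
proof
  have "\<forall>n. \<forall>t>0. (-1) ^ n * (deriv ^^ n) \<mu> t \<ge> 0"
    using assms by (simp add: complete_bernstein_def completely_monotone_def)
  from this[rule_format, of _ 0] show "0 \<le> \<mu> t" if "t > 0" for t
    using that by simp
  show "set_integrable lborel {0<..} (\<lambda>t. min 1 t * \<mu> t)"
    using assms by (simp add: complete_bernstein_def)
qed

theorem theorem3p2:
  fixes \<Phi> \<mu> :: "real \<Rightarrow> real"
    and \<phi> V :: "'a::euclidean_space \<Rightarrow> real"
    and \<Omega> :: "'a set"
  assumes "complete_bernstein \<Phi> \<mu>"
    and "in_L2 (\<lambda>x. complex_of_real (\<phi> x))"
    and "in_Linf \<phi>"
    and "\<And>x. \<phi> x > 0"
    and "zero_energy_solution \<Phi> V \<phi>"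
    and "pointwise_potential \<mu> V \<phi>"
    and "open \<Omega>"
    and "\<phi> \<in> Z_b_loc \<Omega>"
    and "continuous_on \<Omega> \<phi>"
  shows "continuous_on \<Omega> V"
proof -
  interpret levy_density \<mu>
    using assms(1) by (rule complete_bernstein_levy_density)
  define I where "I x = (LINT h|lebesgue. second_diff h \<phi> x * kernel DIM('a) (norm h))" for x
  note I = second_diff_kernel_integral[OF assms(3,8,9,7)]
  have "continuous_on \<Omega> I"
    using I(2) unfolding continuous_on_eq_continuous_at[OF assms(7)] isCont_def I_def by blast
  moreover have "\<phi> x \<noteq> 0" for x
    using assms(4)[of x] by simp
  ultimately have "continuous_on \<Omega> (\<lambda>x. 1 / (2 * \<phi> x) * I x)"
    using assms(9) by (intro continuous_intros) auto
  moreover have "V x = 1 / (2 * \<phi> x) * I x" if "x \<in> \<Omega>" for x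
    using assms(6) I(1)[OF that] by (simp add: pointwise_potential_def I_def)
  ultimately show ?thesis
    by (simp cong: continuous_on_cong)
qed

end
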